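(* Let $W\in\{\mathrm{CWV},\mathrm{WV}\}$ and let $\Pi_1=(\mathcal{A},\mathcal{E},\mathcal{R}_1)$, $\Pi_2=(\mathcal{A},\mathcal{E},\mathcal{R}_2)$ be ELPs. Then $\Pi_1$ and $\Pi_2$ are uniformly $W$-equivalent iff their $W$-UE-functions coincide.
   Context: Logic programs, interpretations, models, GL-reduct and answer sets $AS(\cdot)$ are as usual for disjunctive programs with (nested) default negation $\neg$. An ELP is a triple $(\mathcal{A},\mathcal{E},\mathcal{R})$: $\mathcal{A}$ atoms, $\mathcal{E}$ a set of epistemic literals $\mathbf{not}\,\ell$ ($\ell$ a literal over $\mathcal{A}$), $\mathcal{R}$ a finite set of rules $a_1\vee\cdots\vee a_k\leftarrow\ell_1,\dots,\ell_m,\xi_1,\dots,\xi_j,\neg\xi_{j+1},\dots,\neg\xi_n$ with $\xi_i\in\mathcal{E}$. For $D\subseteq\mathcal{A}$, $\Pi\cup D$ adds the facts $a\leftarrow$ ($a\in D$). For a guess $\Phi\subseteq\mathcal{E}$, the epistemic reduct $\Pi^\Phi$ replaces each $\mathbf{not}\,\ell\in\Phi$ by $\top$ and each remaining $\mathbf{not}$ by $\neg$ (giving an ordinary logic program). A set $\mathcal{I}$ of interpretations is $\Phi$-compatible w.r.t. $\mathcal{E}$ iff $\mathcal{I}\neq\emptyset$, each $\mathbf{not}\,\ell\in\Phi$ has some $I\in\mathcal{I}$ with $I\not\models\ell$, and each $\mathbf{not}\,\ell\in\mathcal{E}\setminus\Phi$ has $I\models\ell$ for all $I\in\mathcal{I}$.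 $\mathcal{M}$ is a candidate world view (CWV) of $\Pi$ w.r.t. $\Phi$ if $\mathcal{M}=AS(\Pi^\Phi)$ is $\Phi$-compatible; it is a world view (WV) if moreover no CWV of $\Pi$ has an associated guess $\Phi'\supsetneq\Phi$. ELPs are uniformly CWV- (resp. WV-) equivalent iff for every $D\subseteq\mathcal{A}$, $\Pi_1\cup D$ and $\Pi_2\cup D$ have the same CWVs (resp. WVs). The $W$-UE-function of $\Pi$ maps each pair $(\Phi,D)$ with $\Phi\subseteq\mathcal{E}$, $D\subseteq\mathcal{A}$ to $\mathcal{M}=AS((\Pi\cup D)^\Phi)$ if $\mathcal{M}$ is a CWV of type $W$ of $\Pi\cup D$ w.r.t. $\Phi$, and to $\emptyset$ otherwise. *)

theory Defs
  imports Main "HOL-Library.FuncSet"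
begin

subsection \<open>Disjunctive programs with nested default negation\<close>

datatype 'a literal = PosLit (lit_atom: 'a) | NegLit (lit_atom: 'a)

text \<open>Body elements of ordinary programs: an atom or \<open>\<top>\<close> under any number of default negations.
  Two or three negations arise from the epistemic reduct.\<close>

datatype 'a nlit = Top | Atom 'a | DNeg "'a nlit"

fun nlit_of :: "'a literal \<Rightarrow> 'a nlit" where
  "nlit_of (PosLit a) = Atom a"
| "nlit_of (NegLit a) = DNeg (Atom a)"

fun nlit_sat :: "'a set \<Rightarrow> 'a nlit \<Rightarrow> bool" where
  "nlit_sat I Top \<longleftrightarrow> True"
| "nlit_sat I (Atom a) \<longleftrightarrow> a \<in> I"
| "nlit_sat I (DNeg x) \<longleftrightarrow> \<not> nlit_sat I x"

definition lit_sat :: "'a set \<Rightarrow> 'a literal \<Rightarrow> bool" where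
  "lit_sat I l \<longleftrightarrow> nlit_sat I (nlit_of l)"

record 'a lp_rule =
  lp_head :: "'a set"
  lp_body :: "'a nlit set"

record 'a lp =
  lp_atoms :: "'a set"
  lp_rules :: "'a lp_rule set"

definition rule_sat :: "'a set \<Rightarrow> 'a lp_rule \<Rightarrow> bool" where
  "rule_sat I r \<longleftrightarrow> ((\<forall>x\<in>lp_body r. nlit_sat I x) \<longrightarrow> (\<exists>a\<in>lp_head r. a \<in> I))"

definition is_model :: "'a set \<Rightarrow> 'a lp \<Rightarrow> bool" where
  "is_model I P \<longleftrightarrow> I \<subseteq> lp_atoms P \<and> (\<forall>r\<in>lp_rules P. rule_sat I r)"

definition gl_reduct :: "'a lp \<Rightarrow> 'a set \<Rightarrow> 'a lp" where
  "gl_reduct P I =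
     \<lparr>lp_atoms = lp_atoms P,
      lp_rules = {\<lparr>lp_head = lp_head r, lp_body = lp_body r - range DNeg\<rparr> | r.
                    r \<in> lp_rules P \<and> (\<forall>x. DNeg x \<in> lp_body r \<longrightarrow> nlit_sat I (DNeg x))}\<rparr>"

definition answer_sets :: "'a lp \<Rightarrow> 'a set set" where
  "answer_sets P = {M. is_model M P \<and> \<not> (\<exists>M'. M' \<subset> M \<and> is_model M' (gl_reduct P M))}"

subsection \<open>Epistemic logic programs\<close>

datatype 'a elit = ENot (elit_lit: "'a literal")

text \<open>A rule \<open>a\<^sub>1 \<or> \<dots> \<or> a\<^sub>k \<leftarrow> l\<^sub>1, \<dots>, l\<^sub>m, \<xi>\<^sub>1, \<dots>, \<xi>\<^sub>j, \<not>\<xi>\<^sub>j\<^sub>+\<^sub>1, \<dots>, \<not>\<xi>\<^sub>n\<close>, with \<open>er_epos\<close> the set of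
  \<open>\<xi>\<^sub>1, \<dots>, \<xi>\<^sub>j\<close> and \<open>er_eneg\<close> the set of \<open>\<xi>\<^sub>j\<^sub>+\<^sub>1, \<dots>, \<xi>\<^sub>n\<close>.\<close>

record 'a elp_rule =
  er_head :: "'a set"
  er_lits :: "'a literal set"
  er_epos :: "'a elit set"
  er_eneg :: "'a elit set"

record 'a elp =
  elp_atoms :: "'a set"
  elp_elits :: "'a elit set"
  elp_rules :: "'a elp_rule set"

definition is_elp_rule :: "'a set \<Rightarrow> 'a elit set \<Rightarrow> 'a elp_rule \<Rightarrow> bool" where
  "is_elp_rule A E r \<longleftrightarrow>
     finite (er_head r) \<and> er_head r \<subseteq> A \<and>
     finite (er_lits r) \<and> lit_atom ` er_lits r \<subseteq> A \<and>
     finite (er_epos r) \<and> er_epos r \<subseteq> E \<and>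
     finite (er_eneg r) \<and> er_eneg r \<subseteq> E"

definition is_elp :: "'a elp \<Rightarrow> bool" where
  "is_elp \<P> \<longleftrightarrow>
     (\<forall>\<xi>\<in>elp_elits \<P>. lit_atom (elit_lit \<xi>) \<in> elp_atoms \<P>) \<and>
     finite (elp_rules \<P>) \<and>
     (\<forall>r\<in>elp_rules \<P>. is_elp_rule (elp_atoms \<P>) (elp_elits \<P>) r)"

definition fact_rule :: "'a \<Rightarrow> 'a elp_rule" where
  "fact_rule a = \<lparr>er_head = {a}, er_lits = {}, er_epos = {}, er_eneg = {}\<rparr>"

definition add_facts :: "'a elp \<Rightarrow> 'a set \<Rightarrow> 'a elp" where
  "add_facts \<P> D = \<P>\<lparr>elp_rules := elp_rules \<P> \<union> fact_rule ` D\<rparr>"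

fun elit_reduct :: "'a elit set \<Rightarrow> 'a elit \<Rightarrow> 'a nlit" where
  "elit_reduct \<Phi> (ENot l) = (if ENot l \<in> \<Phi> then Top else DNeg (nlit_of l))"

definition rule_reduct :: "'a elit set \<Rightarrow> 'a elp_rule \<Rightarrow> 'a lp_rule" where
  "rule_reduct \<Phi> r =
     \<lparr>lp_head = er_head r,
      lp_body = nlit_of ` er_lits r \<union> elit_reduct \<Phi> ` er_epos r
                \<union> (\<lambda>\<xi>. DNeg (elit_reduct \<Phi> \<xi>)) ` er_eneg r\<rparr>"

definition epistemic_reduct :: "'a elp \<Rightarrow> 'a elit set \<Rightarrow> 'a lp" where
  "epistemic_reduct \<P> \<Phi> =
     \<lparr>lp_atoms = elp_atoms \<P>, lp_rules = rule_reduct \<Phi> ` elp_rules \<P>\<rparr>"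

definition compatible :: "'a elit set \<Rightarrow> 'a elit set \<Rightarrow> 'a set set \<Rightarrow> bool" where
  "compatible \<Phi> E \<I> \<longleftrightarrow>
     \<I> \<noteq> {} \<and>
     (\<forall>l. ENot l \<in> \<Phi> \<longrightarrow> (\<exists>I\<in>\<I>. \<not> lit_sat I l)) \<and>
     (\<forall>l. ENot l \<in> E - \<Phi> \<longrightarrow> (\<forall>I\<in>\<I>. lit_sat I l))"

definition is_cwv :: "'a elp \<Rightarrow> 'a elit set \<Rightarrow> 'a set set \<Rightarrow> bool" where
  "is_cwv \<P> \<Phi> \<M> \<longleftrightarrow>
     \<Phi> \<subseteq> elp_elits \<P> \<and>
     \<M> = answer_sets (epistemic_reduct \<P> \<Phi>) \<and>
     compatible \<Phi> (elp_elits \<P>) \<M>"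

definition is_wv :: "'a elp \<Rightarrow> 'a elit set \<Rightarrow> 'a set set \<Rightarrow> bool" where
  "is_wv \<P> \<Phi> \<M> \<longleftrightarrow>
     is_cwv \<P> \<Phi> \<M> \<and> \<not> (\<exists>\<Phi>' \<M>'. is_cwv \<P> \<Phi>' \<M>' \<and> \<Phi> \<subset> \<Phi>')"

subsection \<open>Uniform equivalence and UE-functions\<close>

datatype view_type = CWV | WV

fun is_view :: "view_type \<Rightarrow> 'a elp \<Rightarrow> 'a elit set \<Rightarrow> 'a set set \<Rightarrow> bool" where
  "is_view CWV = is_cwv"
| "is_view WV = is_wv"

definition views :: "view_type \<Rightarrow> 'a elp \<Rightarrow> 'a set set set" where
  "views W \<P> = {\<M>. \<exists>\<Phi>. is_view W \<P> \<Phi> \<M>}"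

text \<open>Meant for programs with \<open>elp_atoms \<P>\<^sub>1 = elp_atoms \<P>\<^sub>2\<close>.\<close>

definition uniformly_equivalent :: "view_type \<Rightarrow> 'a elp \<Rightarrow> 'a elp \<Rightarrow> bool" where
  "uniformly_equivalent W \<P>\<^sub>1 \<P>\<^sub>2 \<longleftrightarrow>
     (\<forall>D. D \<subseteq> elp_atoms \<P>\<^sub>1 \<longrightarrow> views W (add_facts \<P>\<^sub>1 D) = views W (add_facts \<P>\<^sub>2 D))"

text \<open>Restricted to its domain, so that equality of UE-functions is equality on all pairs
  \<open>(\<Phi>, D)\<close> with \<open>\<Phi> \<subseteq> \<E>\<close> and \<open>D \<subseteq> \<A>\<close>.\<close>

definition ue_function :: "view_type \<Rightarrow> 'a elp \<Rightarrow> 'a elit set \<times> 'a set \<Rightarrow> 'a set set" where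
  "ue_function W \<P> =
     (\<lambda>(\<Phi>, D)\<in>Pow (elp_elits \<P>) \<times> Pow (elp_atoms \<P>).
        let \<M> = answer_sets (epistemic_reduct (add_facts \<P> D) \<Phi>)
        in if is_view W (add_facts \<P> D) \<Phi> \<M> then \<M> else {})"

end

theory Submission
  imports Defs
begin

text \<open>A nonempty set of interpretations is compatible with at most one guess \<open>\<Phi> \<subseteq> \<E>\<close>, namely the set
  of those \<open>not l\<close> in \<open>\<E>\<close> for which some interpretation falsifies \<open>l\<close>. Hence the views of a program
  determine their guesses. As views are nonempty, the default value \<open>\<emptyset>\<close> of the UE-function is never
  confused with a view, so the UE-function carries the same information as the sets of views of
  all \<open>\<Pi> \<union> D\<close>.\<close>

lemma compatible_guess_unique:
  assumes "compatible \<Phi> E \<M>" "compatible \<Psi> E \<M>" "\<Phi> \<subseteq> E" "\<Psi> \<subseteq> E"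
  shows "\<Phi> = \<Psi>"
proof -
  have "\<Phi>' = {\<xi> \<in> E. \<exists>I\<in>\<M>. \<not> lit_sat I (elit_lit \<xi>)}"
    if "compatible \<Phi>' E \<M>" "\<Phi>' \<subseteq> E" for \<Phi>'
  proof (rule set_eqI)
    fix \<xi>
    show "\<xi> \<in> \<Phi>' \<longleftrightarrow> \<xi> \<in> {\<xi> \<in> E. \<exists>I\<in>\<M>. \<not> lit_sat I (elit_lit \<xi>)}"
      using that by (cases \<xi>) (auto simp: compatible_def)
  qed
  from this[of \<Phi>] this[of \<Psi>] show ?thesis
    using assms by simp
qed

lemma is_view_imp_is_cwv: "is_view W \<P> \<Phi> \<M> \<Longrightarrow> is_cwv \<P> \<Phi> \<M>"
  by (cases W) (auto simp: is_wv_def)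

lemma elp_elits_add_facts [simp]: "elp_elits (add_facts \<P> D) = elp_elits \<P>"
  by (simp add: add_facts_def)

text \<open>Two programs are allowed because a view common to both must be traced to one guess.
  Every view of either type is a CWV, so compatibility over the shared epistemic literals fixes the
  guess.\<close>

lemma is_view_guess_unique:
  assumes "is_view W \<P>\<^sub>1 \<Phi> \<M>" "is_view W \<P>\<^sub>2 \<Psi> \<M>" "elp_elits \<P>\<^sub>1 = elp_elits \<P>\<^sub>2"
  shows "\<Phi> = \<Psi>"
  using assms(1,2)[THEN is_view_imp_is_cwv] assms(3) compatible_guess_unique
  unfolding is_cwv_def by metis

text \<open>\<open>\<Phi> \<subseteq> elp_elits \<P>\<close> keeps the argument inside the domain of
  the restricted function, and \<open>\<M> \<noteq> {}\<close> rules out the default value.\<close>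

lemma is_view_iff_ue_function:
  assumes "D \<subseteq> elp_atoms \<P>"
  shows "is_view W (add_facts \<P> D) \<Phi> \<M> \<longleftrightarrow>
    \<Phi> \<subseteq> elp_elits \<P> \<and> \<M> \<noteq> {} \<and> ue_function W \<P> (\<Phi>, D) = \<M>"
  using assms is_view_imp_is_cwv[of W "add_facts \<P> D" \<Phi> \<M>]
  by (auto simp: ue_function_def is_cwv_def compatible_def Let_def)

lemma ue_function_eq_iff:
  assumes "elp_atoms \<P>\<^sub>1 = elp_atoms \<P>\<^sub>2" "elp_elits \<P>\<^sub>1 = elp_elits \<P>\<^sub>2"
  shows "ue_function W \<P>\<^sub>1 = ue_function W \<P>\<^sub>2 \<longleftrightarrow>
    (\<forall>D \<Phi> \<M>. D \<subseteq> elp_atoms \<P>\<^sub>1 \<longrightarrow>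
      is_view W (add_facts \<P>\<^sub>1 D) \<Phi> \<M> = is_view W (add_facts \<P>\<^sub>2 D) \<Phi> \<M>)"
    (is "?L \<longleftrightarrow> ?R")
proof
  assume ?L
  then show ?R
    using assms by (simp add: is_view_iff_ue_function)
next
  assume R: ?R
  show ?L
  proof (rule extensionalityI)
    let ?X = "Pow (elp_elits \<P>\<^sub>1) \<times> Pow (elp_atoms \<P>\<^sub>1)"
    show "ue_function W \<P>\<^sub>1 \<in> extensional ?X" "ue_function W \<P>\<^sub>2 \<in> extensional ?X"
      unfolding ue_function_def assms by (rule restrict_extensional)+
    fix p assume "p \<in> ?X"
    then obtain \<Phi> D where p: "p = (\<Phi>, D)" "\<Phi> \<subseteq> elp_elits \<P>\<^sub>1" "D \<subseteq> elp_atoms \<P>\<^sub>1"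
      by auto
    \<comment> \<open>Agreement on nonempty values suffices: if one value is nonempty, take it for
      \<open>\<M>\<close>; otherwise both are empty.\<close>
    then have "\<M> \<noteq> {} \<Longrightarrow> ue_function W \<P>\<^sub>1 p = \<M> \<longleftrightarrow> ue_function W \<P>\<^sub>2 p = \<M>" for \<M>
      using R assms is_view_iff_ue_function[of D \<P>\<^sub>1 W \<Phi> \<M>]
        is_view_iff_ue_function[of D \<P>\<^sub>2 W \<Phi> \<M>] by simp
    then show "ue_function W \<P>\<^sub>1 p = ue_function W \<P>\<^sub>2 p"
      by metis
  qed
qed

lemma views_eq_iff:
  assumes "elp_elits \<P>\<^sub>1 = elp_elits \<P>\<^sub>2"
  shows "views W \<P>\<^sub>1 = views W \<P>\<^sub>2 \<longleftrightarrow> (\<forall>\<Phi> \<M>. is_view W \<P>\<^sub>1 \<Phi> \<M> = is_view W \<P>\<^sub>2 \<Phi> \<M>)"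
proof
  assume "views W \<P>\<^sub>1 = views W \<P>\<^sub>2"
  then have "(\<exists>\<Phi>. is_view W \<P>\<^sub>1 \<Phi> \<M>) \<longleftrightarrow> (\<exists>\<Phi>. is_view W \<P>\<^sub>2 \<Phi> \<M>)" for \<M>
    by (auto simp: views_def set_eq_iff)
  then show "\<forall>\<Phi> \<M>. is_view W \<P>\<^sub>1 \<Phi> \<M> = is_view W \<P>\<^sub>2 \<Phi> \<M>"
    \<comment> \<open>A view of one program for \<open>\<Phi>\<close> is a view of the other for
      some guess, which by uniqueness is \<open>\<Phi>\<close> again.\<close>
    using is_view_guess_unique assms by metis
qed (simp add: views_def)

theorem theorem2:
  fixes W :: view_type
    and A :: "'a set" and E :: "'a elit set" and R\<^sub>1 R\<^sub>2 :: "'a elp_rule set"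
    and \<P>\<^sub>1 \<P>\<^sub>2 :: "'a elp"
  assumes "\<P>\<^sub>1 = \<lparr>elp_atoms = A, elp_elits = E, elp_rules = R\<^sub>1\<rparr>"
    and "\<P>\<^sub>2 = \<lparr>elp_atoms = A, elp_elits = E, elp_rules = R\<^sub>2\<rparr>"
    and "is_elp \<P>\<^sub>1" and "is_elp \<P>\<^sub>2"
  shows "uniformly_equivalent W \<P>\<^sub>1 \<P>\<^sub>2 \<longleftrightarrow> ue_function W \<P>\<^sub>1 = ue_function W \<P>\<^sub>2"
proof -
  have eq: "elp_atoms \<P>\<^sub>1 = elp_atoms \<P>\<^sub>2" "elp_elits \<P>\<^sub>1 = elp_elits \<P>\<^sub>2"
    using assms(1,2) by simp_all
  then have "views W (add_facts \<P>\<^sub>1 D) = views W (add_facts \<P>\<^sub>2 D) \<longleftrightarrow>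
      (\<forall>\<Phi> \<M>. is_view W (add_facts \<P>\<^sub>1 D) \<Phi> \<M> = is_view W (add_facts \<P>\<^sub>2 D) \<Phi> \<M>)" for D
    \<comment> \<open>Adding facts leaves the epistemic literals unchanged, so the two extended
      programs still share them.\<close>
    by (intro views_eq_iff) simp
  then show ?thesis
    unfolding uniformly_equivalent_def ue_function_eq_iff[OF eq] by blast
qed

end
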